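(* Let $(\Omega,\mathcal{A},\mu)$ be a finite measure space, let $X$ be a Banach space, and let $1\le p<\infty$. If $L^p(\mu,X)$ has $BDP$, then $X$ has $BDP$.
   Context: All Banach spaces are real and nontrivial (this includes $L^p(\mu,X)$, so $\mu(\Omega)>0$). For a Banach space $E$, $B_E$ is the closed unit ball and $S_E$ the unit sphere. A slice of $B_E$ is a set $S(B_E,x^*,\alpha)=\{x\in B_E: x^*(x)>1-\alpha\}$ with $x^*\in S_{E^*}$ and $\alpha>0$. $E$ has the Ball Dentable Property ($BDP$) if for every $\varepsilon>0$ there is a slice of $B_E$ with diameter less than $\varepsilon$. $L^p(\mu,X)$ is the Lebesgue-Bochner space of (equivalence classes of) $p$-integrable (strongly measurable) $X$-valued functions on $\Omega$, with norm $\|f\|_p=\left(\int_\Omega\|f(t)\|^p\,d\mu(t)\right)^{1/p}$. *)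

theory Defs
  imports "HOL-Analysis.Analysis"
begin

text \<open>
  The space \<open>L\<^sup>p(\<mu>,X)\<close> depends on the measure \<open>\<mu>\<close> and so is not a type. Real normed spaces are
  therefore represented by an explicit carrier with operations, so that one definition of the Ball
  Dentable Property serves both for \<open>L\<^sup>p(\<mu>,X)\<close> and for a Banach space given as a type.
\<close>

record 'v normed_struct =
  vecs :: "'v set"
  vadd :: "'v \<Rightarrow> 'v \<Rightarrow> 'v"
  vscale :: "real \<Rightarrow> 'v \<Rightarrow> 'v"
  vnorm :: "'v \<Rightarrow> real"

definition unit_ball :: "('v, 'm) normed_struct_scheme \<Rightarrow> 'v set" where
  "unit_ball E = {x \<in> vecs E. vnorm E x \<le> 1}"

definition vdist :: "('v, 'm) normed_struct_scheme \<Rightarrow> 'v \<Rightarrow> 'v \<Rightarrow> real" where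
  "vdist E x y = vnorm E (vadd E x (vscale E (-1) y))"

text \<open>Same convention as \<^const>\<open>diameter\<close>; only used for bounded sets.\<close>

definition vdiameter :: "('v, 'm) normed_struct_scheme \<Rightarrow> 'v set \<Rightarrow> real" where
  "vdiameter E S = (if S = {} then 0 else (SUP (x, y) \<in> S \<times> S. vdist E x y))"

text \<open>Only the values of a functional on the carrier are relevant.\<close>

definition dual_space :: "('v, 'm) normed_struct_scheme \<Rightarrow> ('v \<Rightarrow> real) set" where
  "dual_space E = {\<phi>.
     (\<forall>x\<in>vecs E. \<forall>y\<in>vecs E. \<phi> (vadd E x y) = \<phi> x + \<phi> y) \<and>
     (\<forall>c. \<forall>x\<in>vecs E. \<phi> (vscale E c x) = c * \<phi> x) \<and>
     (\<exists>C. \<forall>x\<in>vecs E. \<bar>\<phi> x\<bar> \<le> C * vnorm E x)}"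

definition dual_norm :: "('v, 'm) normed_struct_scheme \<Rightarrow> ('v \<Rightarrow> real) \<Rightarrow> real" where
  "dual_norm E \<phi> = (SUP x\<in>unit_ball E. \<bar>\<phi> x\<bar>)"

definition dual_sphere :: "('v, 'm) normed_struct_scheme \<Rightarrow> ('v \<Rightarrow> real) set" where
  "dual_sphere E = {\<phi> \<in> dual_space E. dual_norm E \<phi> = 1}"

definition slice :: "('v, 'm) normed_struct_scheme \<Rightarrow> ('v \<Rightarrow> real) \<Rightarrow> real \<Rightarrow> 'v set" where
  "slice E \<phi> \<alpha> = {x \<in> unit_ball E. \<phi> x > 1 - \<alpha>}"

definition BDP :: "('v, 'm) normed_struct_scheme \<Rightarrow> bool" where
  "BDP E \<longleftrightarrow> (\<forall>\<epsilon>>0. \<exists>\<phi>\<in>dual_sphere E. \<exists>\<alpha>>0. vdiameter E (slice E \<phi> \<alpha>) < \<epsilon>)"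

definition type_space :: "'x::real_normed_vector itself \<Rightarrow> 'x normed_struct" where
  "type_space _ = \<lparr>vecs = UNIV, vadd = (+), vscale = (*\<^sub>R), vnorm = norm\<rparr>"

text \<open>On a type, the definitions above agree with the notions of the library.\<close>

lemma BDP_type_space_iff:
  "BDP (type_space TYPE('x::real_normed_vector)) \<longleftrightarrow>
   (\<forall>\<epsilon>>0. \<exists>\<phi> :: 'x \<Rightarrow>\<^sub>L real. norm \<phi> = 1 \<and>
      (\<exists>\<alpha>>0. diameter {x \<in> cball 0 1. blinfun_apply \<phi> x > 1 - \<alpha>} < \<epsilon>))"
proof -
  let ?E = "type_space TYPE('x)"
  have ball: "unit_ball ?E = cball 0 1"
    by (auto simp: unit_ball_def type_space_def)
  have vdist: "vdist ?E x y = dist x y" for x y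
    by (simp add: vdist_def type_space_def dist_norm)
  have diam: "vdiameter ?E = diameter"
    by (rule ext) (simp add: vdiameter_def diameter_def vdist [abs_def])
  have dual: "dual_space ?E = {f. bounded_linear f}"
  proof -
    have "bounded_linear f \<longleftrightarrow> f \<in> dual_space ?E" for f :: "'x \<Rightarrow> real"
      by (auto simp: dual_space_def type_space_def bounded_linear_def
          bounded_linear_axioms_def linear_iff mult.commute)
    then show ?thesis by auto
  qed
  have dnorm: "dual_norm ?E f = onorm f" if f: "bounded_linear f" for f :: "'x \<Rightarrow> real"
  proof (rule antisym)
    have le: "\<bar>f x\<bar> \<le> onorm f" if "x \<in> cball 0 1" for x
    proof -
      have "\<bar>f x\<bar> \<le> onorm f * norm x"
        using onorm[OF f, of x] by simp
      also have "\<dots> \<le> onorm f"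
        using that onorm_pos_le[OF f] by (simp add: mult_left_le)
      finally show ?thesis .
    qed
    then show "dual_norm ?E f \<le> onorm f"
      unfolding dual_norm_def ball by (intro cSUP_least) auto
    have bdd: "bdd_above ((\<lambda>x. \<bar>f x\<bar>) ` cball 0 1)"
      using le by (intro bdd_aboveI2)
    have "norm (f x) \<le> dual_norm ?E f * norm x" for x
    proof (cases "x = 0")
      case True
      then show ?thesis using f by (simp add: linear_simps)
    next
      case False
      have "\<bar>f (sgn x)\<bar> \<le> dual_norm ?E f"
        unfolding dual_norm_def ball using bdd
        by (rule cSUP_upper[rotated]) (simp add: norm_sgn)
      moreover have "f (sgn x) = f x / norm x"
        using f by (simp add: sgn_div_norm linear_simps divide_inverse_commute)
      ultimately show ?thesis
        using False by (simp add: divide_le_eq)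
    qed
    moreover have "0 \<le> dual_norm ?E f"
      unfolding dual_norm_def ball using bdd by (intro cSUP_upper2[of _ _ 0]) auto
    ultimately show "onorm f \<le> dual_norm ?E f"
      by (intro onorm_bound) auto
  qed
  have sphere: "dual_sphere ?E = blinfun_apply ` {\<phi> :: 'x \<Rightarrow>\<^sub>L real. norm \<phi> = 1}"
  proof (intro set_eqI iffI)
    fix f assume "f \<in> dual_sphere ?E"
    then have "bounded_linear f" "onorm f = 1"
      using dual dnorm by (auto simp: dual_sphere_def)
    then show "f \<in> blinfun_apply ` {\<phi>. norm \<phi> = 1}"
      by (intro image_eqI[of _ _ "Blinfun f"])
        (auto simp: bounded_linear_Blinfun_apply norm_blinfun.rep_eq)
  next
    fix f assume "f \<in> blinfun_apply ` {\<phi> :: 'x \<Rightarrow>\<^sub>L real. norm \<phi> = 1}"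
    then show "f \<in> dual_sphere ?E"
      using dual dnorm
      by (auto simp: dual_sphere_def norm_blinfun.rep_eq blinfun.bounded_linear_right)
  qed
  show ?thesis
    by (simp add: BDP_def slice_def ball diam sphere Bex_def image_iff) blast
qed

text \<open>
  Limits of simple functions are required everywhere rather than almost everywhere, so that
  \<open>\<lambda>w. norm (f w)\<close> is measurable even if \<open>M\<close> is not complete. Up to equality almost everywhere
  this makes no difference. The values may form a nonseparable space, so Borel measurability
  would be too weak. Values outside \<^term>\<open>space M\<close> are irrelevant.
\<close>

definition strongly_measurable :: "'w measure \<Rightarrow> ('w \<Rightarrow> 'x::real_normed_vector) \<Rightarrow> bool" where
  "strongly_measurable M f \<longleftrightarrow>
     (\<exists>s. (\<forall>i. simple_function M (s i)) \<and> (\<forall>w\<in>space M. (\<lambda>i. s i w) \<longlonglongrightarrow> f w))"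

definition Lp_fun :: "'w measure \<Rightarrow> real \<Rightarrow> ('w \<Rightarrow> 'x::real_normed_vector) set" where
  "Lp_fun M p = {f. strongly_measurable M f \<and> integrable M (\<lambda>w. norm (f w) powr p)}"

definition Lp_norm :: "'w measure \<Rightarrow> real \<Rightarrow> ('w \<Rightarrow> 'x::real_normed_vector) \<Rightarrow> real" where
  "Lp_norm M p f = (\<integral>w. norm (f w) powr p \<partial>M) powr (1 / p)"

definition Lp_rel :: "'w measure \<Rightarrow> real \<Rightarrow> (('w \<Rightarrow> 'x::real_normed_vector) \<times> ('w \<Rightarrow> 'x)) set" where
  "Lp_rel M p = {(f, g). f \<in> Lp_fun M p \<and> g \<in> Lp_fun M p \<and> (AE w in M. f w = g w)}"

definition Lp :: "'w measure \<Rightarrow> real \<Rightarrow> 'x::real_normed_vector itself \<Rightarrow> ('w \<Rightarrow> 'x) set normed_struct" where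
  "Lp M p _ = \<lparr>
     vecs = Lp_fun M p // Lp_rel M p,
     vadd = (\<lambda>A B. \<Union>f\<in>A. \<Union>g\<in>B. Lp_rel M p `` {\<lambda>w. f w + g w}),
     vscale = (\<lambda>c A. \<Union>f\<in>A. Lp_rel M p `` {\<lambda>w. c *\<^sub>R f w}),
     vnorm = (\<lambda>A. the_elem (Lp_norm M p ` A))\<rparr>"

lemma strongly_measurable_add:
  assumes "strongly_measurable M f" "strongly_measurable M g"
  shows "strongly_measurable M (\<lambda>w. f w + g w)"
proof -
  obtain s t where "\<And>i. simple_function M (s i)" "\<And>i. simple_function M (t i)"
    "\<And>w. w \<in> space M \<Longrightarrow> (\<lambda>i. s i w) \<longlonglongrightarrow> f w" "\<And>w. w \<in> space M \<Longrightarrow> (\<lambda>i. t i w) \<longlonglongrightarrow> g w"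
    using assms unfolding strongly_measurable_def by blast
  then show ?thesis
    unfolding strongly_measurable_def
    by (intro exI[of _ "\<lambda>i w. s i w + t i w"]) (auto intro!: tendsto_add)
qed

lemma strongly_measurable_scaleR:
  assumes "strongly_measurable M f"
  shows "strongly_measurable M (\<lambda>w. c *\<^sub>R f w)"
proof -
  obtain s where "\<And>i. simple_function M (s i)" "\<And>w. w \<in> space M \<Longrightarrow> (\<lambda>i. s i w) \<longlonglongrightarrow> f w"
    using assms unfolding strongly_measurable_def by blast
  then show ?thesis
    unfolding strongly_measurable_def
    by (intro exI[of _ "\<lambda>i w. c *\<^sub>R s i w"])
      (auto intro!: tendsto_scaleR simple_function_compose1[where g = "(*\<^sub>R) c"])
qed

lemma strongly_measurable_norm:
  assumes "strongly_measurable M f"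
  shows "(\<lambda>w. norm (f w)) \<in> borel_measurable M"
proof -
  obtain s where s: "\<And>i. simple_function M (s i)"
    and lim: "\<And>w. w \<in> space M \<Longrightarrow> (\<lambda>i. s i w) \<longlonglongrightarrow> f w"
    using assms unfolding strongly_measurable_def by blast
  show ?thesis
  proof (rule borel_measurable_LIMSEQ_real)
    show "(\<lambda>w. norm (s i w)) \<in> borel_measurable M" for i
      by (rule borel_measurable_simple_function, rule simple_function_compose1, rule s)
    show "(\<lambda>i. norm (s i w)) \<longlonglongrightarrow> norm (f w)" if "w \<in> space M" for w
      by (rule tendsto_norm, rule lim, rule that)
  qed
qed

lemma Lp_fun_add:
  assumes "p \<ge> 0" and f: "f \<in> Lp_fun M p" and g: "g \<in> Lp_fun M p"
  shows "(\<lambda>w. f w + g w) \<in> Lp_fun M p"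
proof -
  have sm: "strongly_measurable M (\<lambda>w. f w + g w)"
    using f g by (auto simp: Lp_fun_def intro: strongly_measurable_add)
  have le: "norm (x + y) powr p \<le> 2 powr p * (norm x powr p + norm y powr p)" for x y :: 'b
  proof -
    have "norm (x + y) powr p \<le> (2 * max (norm x) (norm y)) powr p"
      using \<open>p \<ge> 0\<close> by (intro powr_mono2) (auto intro: order_trans[OF norm_triangle_ineq])
    also have "\<dots> = 2 powr p * (max (norm x) (norm y)) powr p"
      by (simp add: powr_mult)
    also have "\<dots> \<le> 2 powr p * (norm x powr p + norm y powr p)"
      by (intro mult_left_mono) (auto simp: max_def)
    finally show ?thesis .
  qed
  have "integrable M (\<lambda>w. 2 powr p * (norm (f w) powr p + norm (g w) powr p))"
    using f g by (auto simp: Lp_fun_def)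
  then have "integrable M (\<lambda>w. norm (f w + g w) powr p)"
    using strongly_measurable_norm[OF sm] le
    by (elim Bochner_Integration.integrable_bound) (auto intro!: order_trans[OF le])
  with sm show ?thesis
    by (simp add: Lp_fun_def)
qed

lemma Lp_fun_scaleR:
  assumes "f \<in> Lp_fun M p"
  shows "(\<lambda>w. c *\<^sub>R f w) \<in> Lp_fun M p"
  using assms by (auto simp: Lp_fun_def powr_mult intro!: strongly_measurable_scaleR)

lemma equiv_Lp_rel:
  "equiv (Lp_fun M p) (Lp_rel M p :: (('w \<Rightarrow> 'x::real_normed_vector) \<times> ('w \<Rightarrow> 'x)) set)"
proof (rule equivI)
  show "sym (Lp_rel M p :: (('w \<Rightarrow> 'x) \<times> _) set)"
  proof (rule symI)
    fix f g :: "'w \<Rightarrow> 'x" assume *: "(f, g) \<in> Lp_rel M p"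
    then have "AE w in M. f w = g w"
      by (simp add: Lp_rel_def)
    then have "AE w in M. g w = f w"
      by eventually_elim simp
    with * show "(g, f) \<in> Lp_rel M p"
      by (simp add: Lp_rel_def)
  qed
  show "trans (Lp_rel M p :: (('w \<Rightarrow> 'x) \<times> _) set)"
  proof (rule transI)
    fix f g h :: "'w \<Rightarrow> 'x" assume *: "(f, g) \<in> Lp_rel M p" "(g, h) \<in> Lp_rel M p"
    then have "AE w in M. f w = g w" "AE w in M. g w = h w"
      by (auto simp: Lp_rel_def)
    then have "AE w in M. f w = h w"
      by eventually_elim simp
    with * show "(f, h) \<in> Lp_rel M p"
      by (auto simp: Lp_rel_def)
  qed
qed (auto simp: Lp_rel_def refl_on_def)

lemma Lp_vecs_iff: "A \<in> vecs (Lp M p TYPE('x::real_normed_vector)) \<longleftrightarrow>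
    (\<exists>f\<in>Lp_fun M p. A = Lp_rel M p `` {f :: 'w \<Rightarrow> 'x})"
  by (auto simp: Lp_def quotient_def)

text \<open>The operations on classes do not depend on representatives.\<close>

lemma Lp_vadd_class:
  fixes f g :: "'w \<Rightarrow> 'x::real_normed_vector"
  assumes "p \<ge> 0" "f \<in> Lp_fun M p" "g \<in> Lp_fun M p"
  shows "vadd (Lp M p TYPE('x)) (Lp_rel M p `` {f}) (Lp_rel M p `` {g}) =
    Lp_rel M p `` {\<lambda>w. f w + g w}"
proof -
  have "(\<lambda>(f :: 'w \<Rightarrow> 'x) (g :: 'w \<Rightarrow> 'x). Lp_rel M p `` {\<lambda>w. f w + g w}) respects2 (Lp_rel M p)"
  proof (rule congruent2I')
    fix f f' g g' :: "'w \<Rightarrow> 'x"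
    assume *: "(f, f') \<in> Lp_rel M p" "(g, g') \<in> Lp_rel M p"
    then have "AE w in M. f w + g w = f' w + g' w"
      by (auto simp: Lp_rel_def)
    with * have "((\<lambda>w. f w + g w), (\<lambda>w. f' w + g' w)) \<in> Lp_rel M p"
      using \<open>p \<ge> 0\<close> by (auto simp: Lp_rel_def Lp_fun_add)
    then show "Lp_rel M p `` {\<lambda>w. f w + g w} = Lp_rel M p `` {\<lambda>w. f' w + g' w}"
      by (rule equiv_class_eq[OF equiv_Lp_rel])
  qed
  from UN_equiv_class2[OF equiv_Lp_rel equiv_Lp_rel this assms(2,3)] show ?thesis
    by (simp add: Lp_def)
qed

lemma Lp_vscale_class:
  fixes f :: "'w \<Rightarrow> 'x::real_normed_vector"
  assumes "f \<in> Lp_fun M p"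
  shows "vscale (Lp M p TYPE('x)) c (Lp_rel M p `` {f}) = Lp_rel M p `` {\<lambda>w. c *\<^sub>R f w}"
proof -
  have "(\<lambda>f :: 'w \<Rightarrow> 'x. Lp_rel M p `` {\<lambda>w. c *\<^sub>R f w}) respects (Lp_rel M p)"
  proof (rule congruentI)
    fix f f' :: "'w \<Rightarrow> 'x"
    assume *: "(f, f') \<in> Lp_rel M p"
    then have "AE w in M. c *\<^sub>R f w = c *\<^sub>R f' w"
      by (auto simp: Lp_rel_def)
    with * have "((\<lambda>w. c *\<^sub>R f w), (\<lambda>w. c *\<^sub>R f' w)) \<in> Lp_rel M p"
      by (auto simp: Lp_rel_def Lp_fun_scaleR)
    then show "Lp_rel M p `` {\<lambda>w. c *\<^sub>R f w} = Lp_rel M p `` {\<lambda>w. c *\<^sub>R f' w}"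
      by (rule equiv_class_eq[OF equiv_Lp_rel])
  qed
  from UN_equiv_class[OF equiv_Lp_rel this assms] show ?thesis
    by (simp add: Lp_def)
qed

lemma Lp_vnorm_class:
  fixes f :: "'w \<Rightarrow> 'x::real_normed_vector"
  assumes "f \<in> Lp_fun M p"
  shows "vnorm (Lp M p TYPE('x)) (Lp_rel M p `` {f}) = Lp_norm M p f"
proof -
  have eq: "Lp_norm M p g = Lp_norm M p f" if g: "(f, g) \<in> Lp_rel M p" for g
  proof -
    have "(\<integral>w. norm (g w) powr p \<partial>M) = (\<integral>w. norm (f w) powr p \<partial>M)"
      using g by (intro integral_cong_AE)
        (auto simp: Lp_rel_def Lp_fun_def intro: borel_measurable_integrable)
    then show ?thesis
      by (simp add: Lp_norm_def)
  qed
  have "(f, f) \<in> Lp_rel M p"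
    using assms by (simp add: Lp_rel_def)
  then have "Lp_norm M p ` (Lp_rel M p `` {f}) = {Lp_norm M p f}"
    by (intro equalityI subsetI) (blast intro: eq, blast)
  then show ?thesis
    by (simp add: Lp_def)
qed

end

theory Submission
  imports Defs
begin

text \<open>
  Let a slice of the unit ball of \<open>L\<^sup>p(\<mu>,X)\<close> be given by \<open>\<phi>\<close> and \<open>\<alpha>\<close>. By density it contains
  a simple function \<open>s = \<Sum> x 1\<^bsub>{s = x}\<^esub>\<close> of norm \<open>1\<close>. Every choice of vectors \<open>y\<^sub>x \<in> B\<^sub>X\<close> yields a
  function \<open>\<Sum> \<parallel>x\<parallel> y\<^sub>x 1\<^bsub>{s = x}\<^esub>\<close> of norm at most \<open>1\<close>, and \<open>\<phi>\<close> maps it to \<open>\<Sum> g\<^sub>x(y\<^sub>x)\<close> for suitable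
  \<open>g\<^sub>x \<in> X\<^sup>*\<close>. Since \<open>\<Sum> \<parallel>g\<^sub>x\<parallel> \<ge> \<phi>(s) > 1 - \<alpha>\<close>, the function lies in the slice as soon as each
  \<open>y\<^sub>x\<close> lies in a sufficiently thin slice of \<open>B\<^sub>X\<close> defined by \<open>g\<^sub>x\<close>. If all slices of \<open>B\<^sub>X\<close> had
  diameter at least \<open>\<eta>\<close>, two such choices could be made at distance at least \<open>\<eta>/2\<close> for each \<open>x\<close>, and
  the two functions would be at distance at least \<open>\<eta>/2\<close>.
\<close>

section \<open>Elementary estimates for the p-norm\<close>

lemma Lp_norm_scaleR:
  assumes "p > 0"
  shows "Lp_norm M p (\<lambda>w. c *\<^sub>R f w) = \<bar>c\<bar> * Lp_norm M p f"
  using assms by (simp add: Lp_norm_def powr_mult powr_powr)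

lemma Lp_norm_nonneg: "Lp_norm M p f \<ge> 0"
  by (simp add: Lp_norm_def)

lemma Lp_norm_mono:
  assumes "p > 0" "f \<in> Lp_fun M p" "g \<in> Lp_fun M p"
    and "\<And>w. w \<in> space M \<Longrightarrow> norm (f w) \<le> norm (g w)"
  shows "Lp_norm M p f \<le> Lp_norm M p g"
  unfolding Lp_norm_def using assms
  by (intro powr_mono2 integral_mono) (auto simp: Lp_fun_def intro!: integral_nonneg_AE)

text \<open>A bound coarser than Minkowski's, from the pointwise estimate \<open>le\<close> by
  integration. It serves to show that distances within the unit ball of L^p are bounded.\<close>

lemma Lp_norm_add_le:
  assumes p: "p \<ge> 1" and f: "f \<in> Lp_fun M p" "Lp_norm M p f \<le> 1"
    and g: "g \<in> Lp_fun M p" "Lp_norm M p g \<le> 1"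
  shows "Lp_norm M p (\<lambda>w. f w + g w) \<le> (2 powr p * 2) powr (1 / p)"
proof -
  have int: "(\<integral>w. norm (h w) powr p \<partial>M) \<le> 1" if "Lp_norm M p h \<le> 1" for h :: "'a \<Rightarrow> 'b"
  proof -
    have "Lp_norm M p h powr p \<le> 1 powr p"
      using that p by (intro powr_mono2) (auto simp: Lp_norm_nonneg)
    then show ?thesis using p by (simp add: Lp_norm_def powr_powr)
  qed
  have le: "norm (x + y) powr p \<le> 2 powr p * (norm x powr p + norm y powr p)" for x y :: 'b
  proof -
    have "norm (x + y) powr p \<le> (2 * max (norm x) (norm y)) powr p"
      using p by (intro powr_mono2) (auto intro: order_trans[OF norm_triangle_ineq])
    also have "\<dots> = 2 powr p * (max (norm x) (norm y)) powr p"
      by (simp add: powr_mult)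
    also have "\<dots> \<le> 2 powr p * (norm x powr p + norm y powr p)"
      by (intro mult_left_mono) (auto simp: max_def)
    finally show ?thesis .
  qed
  have "(\<integral>w. norm (f w + g w) powr p \<partial>M)
      \<le> (\<integral>w. 2 powr p * (norm (f w) powr p + norm (g w) powr p) \<partial>M)"
    using Lp_fun_add[of p f M g] p f g le by (intro integral_mono) (auto simp: Lp_fun_def)
  also have "\<dots> = 2 powr p * ((\<integral>w. norm (f w) powr p \<partial>M) + (\<integral>w. norm (g w) powr p \<partial>M))"
    using f g by (auto simp: Lp_fun_def)
  also have "\<dots> \<le> 2 powr p * 2"
    using int[OF f(2)] int[OF g(2)] by (intro mult_left_mono) auto
  finally show ?thesis
    unfolding Lp_norm_def using p by (intro powr_mono2) auto
qed

section \<open>Simple functions and their density in L^p\<close>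

lemma strongly_measurable_simple_function:
  "simple_function M f \<Longrightarrow> strongly_measurable M f"
  unfolding strongly_measurable_def by (intro exI[of _ "\<lambda>_. f"]) auto

text \<open>Finiteness of the measure enters here: every level set has finite measure, so a simple
  function of the norm is integrable.\<close>

lemma (in finite_measure) simple_function_Lp_fun:
  fixes f :: "'a \<Rightarrow> 'x::real_normed_vector"
  assumes f: "simple_function M f"
  shows "f \<in> Lp_fun M p"
proof -
  have sf: "simple_function M (\<lambda>w. norm (f w) powr p)"
    by (rule simple_function_compose1[OF f])
  have "integrable M (\<lambda>w. norm (f w) powr p)"
    using emeasure_finite
    by (intro integrableI_simple_bochner_integrable simple_bochner_integrable.intros sf) simp
  then show ?thesis
    using strongly_measurable_simple_function[OF f] by (simp add: Lp_fun_def)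
qed

text \<open>Dominated convergence with a multiple of \<open>norm (f w) powr p\<close> as majorant,
  applied once to the differences and once to the approximants themselves. Convergence of the norms
  is what later allows the approximants to be normalised.\<close>

lemma Lp_simple_approx:
  fixes f :: "'w \<Rightarrow> 'x::real_normed_vector"
  assumes p: "p \<ge> 1" and f: "f \<in> Lp_fun M p"
  obtains s where "\<And>i. simple_function M (s i)"
    "(\<lambda>i. Lp_norm M p (\<lambda>w. f w - s i w)) \<longlonglongrightarrow> 0"
    "(\<lambda>i. Lp_norm M p (s i)) \<longlonglongrightarrow> Lp_norm M p f"
proof -
  obtain t where t: "\<And>i. simple_function M (t i)"
    and lim: "\<And>w. w \<in> space M \<Longrightarrow> (\<lambda>i. t i w) \<longlonglongrightarrow> f w"
    using f unfolding Lp_fun_def strongly_measurable_def by blast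
  have int: "integrable M (\<lambda>w. norm (f w) powr p)" and fm: "strongly_measurable M f"
    using f by (auto simp: Lp_fun_def)
  \<comment> \<open>Truncation of \<open>t i\<close> where it exceeds \<open>2 \<parallel>f\<parallel>\<close> makes dominated convergence applicable.\<close>
  define s where "s i w = (if norm (t i w) \<le> 2 * norm (f w) then t i w else 0)" for i w
  have s: "simple_function M (s i)" for i
  proof -
    have nt: "(\<lambda>w. norm (t i w)) \<in> borel_measurable M"
      using strongly_measurable_norm[OF strongly_measurable_simple_function[OF t]] .
    have nf: "(\<lambda>w. norm (f w)) \<in> borel_measurable M"
      by (rule strongly_measurable_norm[OF fm])
    have "{w \<in> space M. norm (t i w) \<le> 2 * norm (f w)} \<in> sets M"
      using nt nf by measurable
    then show ?thesis
      unfolding s_def [abs_def] using t by (intro simple_function_If) auto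
  qed
  \<comment> \<open>Where \<open>f w = 0\<close> the truncation forces the value 0. Elsewhere
    \<open>norm (t i w)\<close> is eventually below \<open>2 * norm (f w)\<close>, so the truncation
    eventually changes nothing.\<close>
  have s_lim: "(\<lambda>i. s i w) \<longlonglongrightarrow> f w" if w: "w \<in> space M" for w
  proof (cases "f w = 0")
    case True
    then have "s i w = 0" for i by (simp add: s_def)
    then show ?thesis using True by simp
  next
    case False
    have "(\<lambda>i. norm (t i w)) \<longlonglongrightarrow> norm (f w)"
      by (intro tendsto_norm lim w)
    then have "eventually (\<lambda>i. norm (t i w) < 2 * norm (f w)) sequentially"
      by (rule order_tendstoD) (use False in simp)
    then have "eventually (\<lambda>i. t i w = s i w) sequentially"
      by eventually_elim (simp add: s_def)
    from Lim_transform_eventually[OF lim[OF w] this] show ?thesis .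
  qed
  have sm: "strongly_measurable M (s i)" for i
    by (rule strongly_measurable_simple_function[OF s])
  have dm: "strongly_measurable M (\<lambda>w. f w - s i w)" for i
    using strongly_measurable_add[OF fm strongly_measurable_scaleR[OF sm, of "-1"]] by simp
  have le: "norm (s i w) \<le> 2 * norm (f w)" "norm (f w - s i w) \<le> 3 * norm (f w)" for i w
    using norm_triangle_ineq4[of "f w" "s i w"] by (auto simp: s_def)
  have "(\<lambda>i. \<integral>w. norm (f w - s i w) powr p \<partial>M) \<longlonglongrightarrow> (\<integral>w. 0 \<partial>M)"
  proof (rule integral_dominated_convergence[where w = "\<lambda>w. 3 powr p * norm (f w) powr p"])
    show "AE w in M. (\<lambda>i. norm (f w - s i w) powr p) \<longlonglongrightarrow> 0"
    proof (rule AE_I2)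
      fix w assume "w \<in> space M"
      then have "(\<lambda>i. norm (f w - s i w)) \<longlonglongrightarrow> 0"
        using tendsto_norm[OF tendsto_diff[OF tendsto_const s_lim], of w "f w"] by simp
      then show "(\<lambda>i. norm (f w - s i w) powr p) \<longlonglongrightarrow> 0"
        using p by (intro tendsto_eq_rhs[OF tendsto_powr2[OF _ tendsto_const]]) auto
    qed
    show "AE w in M. norm (norm (f w - s i w) powr p) \<le> 3 powr p * norm (f w) powr p" for i
      using p le by (auto simp: powr_mult[symmetric] intro!: powr_mono2)
  qed (use int strongly_measurable_norm[OF dm] in auto)
  then have 1: "(\<lambda>i. Lp_norm M p (\<lambda>w. f w - s i w)) \<longlonglongrightarrow> 0"
    unfolding Lp_norm_def using p
    by (intro tendsto_eq_rhs[OF tendsto_powr2[OF _ tendsto_const]]) auto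
  have "(\<lambda>i. \<integral>w. norm (s i w) powr p \<partial>M) \<longlonglongrightarrow> (\<integral>w. norm (f w) powr p \<partial>M)"
  proof (rule integral_dominated_convergence[where w = "\<lambda>w. 2 powr p * norm (f w) powr p"])
    show "AE w in M. (\<lambda>i. norm (s i w) powr p) \<longlonglongrightarrow> norm (f w) powr p"
      using p by (intro AE_I2 tendsto_powr2 tendsto_norm s_lim tendsto_const) auto
    show "AE w in M. norm (norm (s i w) powr p) \<le> 2 powr p * norm (f w) powr p" for i
      using p le by (auto simp: powr_mult[symmetric] intro!: powr_mono2)
  qed (use int strongly_measurable_norm[OF sm] in auto)
  then have 2: "(\<lambda>i. Lp_norm M p (s i)) \<longlonglongrightarrow> Lp_norm M p f"
    unfolding Lp_norm_def using p by (intro tendsto_powr2 tendsto_const) auto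
  show ?thesis by (rule that[OF s 1 2])
qed

section \<open>Sums, distances and diameters in L^p\<close>

lemma Lp_fun_diff:
  assumes "p \<ge> 0" "f \<in> Lp_fun M p" "g \<in> Lp_fun M p"
  shows "(\<lambda>w. f w - g w) \<in> Lp_fun M p"
  using Lp_fun_add[OF assms(1,2) Lp_fun_scaleR[OF assms(3), of "-1"]] by simp

lemma Lp_fun_sum:
  assumes "p \<ge> 0" "finite I" "\<And>i. i \<in> I \<Longrightarrow> f i \<in> Lp_fun M p"
  shows "(\<lambda>w. \<Sum>i\<in>I. f i w) \<in> Lp_fun M p"
  using assms(2,3)
proof (induction I rule: finite_induct)
  case empty
  have "simple_function M (\<lambda>w. 0 :: 'c)" by simp
  then show ?case
    by (simp add: Lp_fun_def strongly_measurable_simple_function)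
next
  case (insert i I)
  then show ?case using Lp_fun_add[OF assms(1), of "f i" M "\<lambda>w. \<Sum>i\<in>I. f i w"] by simp
qed

lemma Lp_vdist_class:
  fixes f g :: "'w \<Rightarrow> 'x::real_normed_vector"
  assumes "p \<ge> 0" "f \<in> Lp_fun M p" "g \<in> Lp_fun M p"
  shows "vdist (Lp M p TYPE('x)) (Lp_rel M p `` {f}) (Lp_rel M p `` {g}) =
    Lp_norm M p (\<lambda>w. f w - g w)"
  using assms Lp_fun_diff[OF assms]
  by (simp add: vdist_def Lp_vscale_class Lp_vadd_class Lp_fun_scaleR[where c = "-1", simplified]
      Lp_vnorm_class)

lemma Lp_unit_ball_class_iff:
  fixes f :: "'w \<Rightarrow> 'x::real_normed_vector"
  assumes "f \<in> Lp_fun M p"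
  shows "Lp_rel M p `` {f} \<in> unit_ball (Lp M p TYPE('x)) \<longleftrightarrow> Lp_norm M p f \<le> 1"
  using assms by (auto simp: unit_ball_def Lp_vecs_iff Lp_vnorm_class)

text \<open>A real supremum dominates its members only if the set is bounded above. Inside the unit
  ball this is guaranteed by \<open>Lp_norm_add_le\<close>.\<close>

lemma Lp_vdist_le_vdiameter:
  fixes M :: "'w measure"
  assumes p: "p \<ge> 1" and S: "S \<subseteq> unit_ball (Lp M p TYPE('x::real_normed_vector))"
    and "A \<in> S" "B \<in> S"
  shows "vdist (Lp M p TYPE('x)) A B \<le> vdiameter (Lp M p TYPE('x)) S"
proof -
  let ?E = "Lp M p TYPE('x)"
  have "vdist ?E A' B' \<le> (2 powr p * 2) powr (1 / p)" if "A' \<in> S" "B' \<in> S" for A' B'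
  proof -
    have "A' \<in> vecs ?E" "B' \<in> vecs ?E"
      using that S by (auto simp: unit_ball_def)
    then obtain f g where f: "f \<in> Lp_fun M p" "A' = Lp_rel M p `` {f}"
      and g: "g \<in> Lp_fun M p" "B' = Lp_rel M p `` {g}"
      unfolding Lp_vecs_iff by blast
    have "Lp_norm M p f \<le> 1" "Lp_norm M p g \<le> 1"
      using that S f g Lp_unit_ball_class_iff by blast+
    then have "Lp_norm M p (\<lambda>w. f w + (-1) *\<^sub>R g w) \<le> (2 powr p * 2) powr (1 / p)"
      using p f(1) g(1) Lp_norm_scaleR[of p M "-1" g]
      by (intro Lp_norm_add_le Lp_fun_scaleR) auto
    then show ?thesis
      using p f g by (simp add: Lp_vdist_class)
  qed
  then have "bdd_above ((\<lambda>(A, B). vdist ?E A B) ` (S \<times> S))"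
    by (intro bdd_aboveI2[where M = "(2 powr p * 2) powr (1 / p)"]) auto
  from cSUP_upper[OF _ this, of "(A, B)"] show ?thesis
    using assms(3,4) by (auto simp: vdiameter_def)
qed

section \<open>Bounded functionals on L^p\<close>

context
  fixes M :: "'w measure" and p :: real and \<phi> :: "('w \<Rightarrow> 'x::real_normed_vector) set \<Rightarrow> real"
  assumes p: "p \<ge> 1" and \<phi>: "\<phi> \<in> dual_space (Lp M p TYPE('x))"
begin

lemma Lp_dual_add:
  assumes "f \<in> Lp_fun M p" "g \<in> Lp_fun M p"
  shows "\<phi> (Lp_rel M p `` {\<lambda>w. f w + g w}) = \<phi> (Lp_rel M p `` {f}) + \<phi> (Lp_rel M p `` {g})"
proof -
  have "Lp_rel M p `` {f} \<in> vecs (Lp M p TYPE('x))" "Lp_rel M p `` {g} \<in> vecs (Lp M p TYPE('x))"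
    using assms by (auto simp: Lp_vecs_iff)
  then show ?thesis
    using \<phi> p assms by (simp add: dual_space_def flip: Lp_vadd_class)
qed

lemma Lp_dual_scaleR:
  assumes "f \<in> Lp_fun M p"
  shows "\<phi> (Lp_rel M p `` {\<lambda>w. c *\<^sub>R f w}) = c * \<phi> (Lp_rel M p `` {f})"
proof -
  have "Lp_rel M p `` {f} \<in> vecs (Lp M p TYPE('x))"
    using assms by (auto simp: Lp_vecs_iff)
  then show ?thesis
    using \<phi> assms by (simp add: dual_space_def flip: Lp_vscale_class)
qed

lemma Lp_dual_diff:
  assumes "f \<in> Lp_fun M p" "g \<in> Lp_fun M p"
  shows "\<phi> (Lp_rel M p `` {\<lambda>w. f w - g w}) = \<phi> (Lp_rel M p `` {f}) - \<phi> (Lp_rel M p `` {g})"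
  using Lp_dual_add[OF Lp_fun_diff[of p, OF _ assms] assms(2)] p by simp

lemma Lp_dual_sum:
  assumes "finite I" "\<And>i. i \<in> I \<Longrightarrow> f i \<in> Lp_fun M p"
  shows "\<phi> (Lp_rel M p `` {\<lambda>w. \<Sum>i\<in>I. f i w}) = (\<Sum>i\<in>I. \<phi> (Lp_rel M p `` {f i}))"
  using assms
proof (induction I rule: finite_induct)
  case empty
  have "(\<lambda>w. 0 :: 'x) \<in> Lp_fun M p"
    using Lp_fun_sum[of p "{}" _ M] p by simp
  from Lp_dual_scaleR[OF this, of 0] show ?case by simp
next
  case (insert i I)
  then show ?case
    using p Lp_dual_add[of "f i" "\<lambda>w. \<Sum>i\<in>I. f i w"] Lp_fun_sum[of p I f M] by simp
qed

lemma Lp_dual_bound: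
  obtains C where "C \<ge> 0" "\<And>f. f \<in> Lp_fun M p \<Longrightarrow> \<bar>\<phi> (Lp_rel M p `` {f})\<bar> \<le> C * Lp_norm M p f"
proof -
  obtain C where C: "\<forall>A\<in>vecs (Lp M p TYPE('x)). \<bar>\<phi> A\<bar> \<le> C * vnorm (Lp M p TYPE('x)) A"
    using \<phi> by (auto simp: dual_space_def)
  show ?thesis
  proof (rule that[of "\<bar>C\<bar>"])
    fix f :: "'w \<Rightarrow> 'x" assume f: "f \<in> Lp_fun M p"
    then have "\<bar>\<phi> (Lp_rel M p `` {f})\<bar> \<le> C * Lp_norm M p f"
      using C by (force simp: Lp_vecs_iff simp flip: Lp_vnorm_class)
    also have "\<dots> \<le> \<bar>C\<bar> * Lp_norm M p f"
      by (intro mult_right_mono) (auto simp: Lp_norm_nonneg)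
    finally show "\<bar>\<phi> (Lp_rel M p `` {f})\<bar> \<le> \<bar>C\<bar> * Lp_norm M p f" .
  qed simp
qed

text \<open>A ball element on which the functional exceeds \<open>\<beta>\<close> is approximated by
  simple functions, one of which is then normalised. Norm exactly 1 is needed later, when the
  distance of two functions is bounded below by a multiple of the norm of \<open>s\<close>.\<close>

lemma Lp_dual_norming_simple_function:
  assumes fin: "finite_measure M" and norm1: "dual_norm (Lp M p TYPE('x)) \<phi> = 1"
    and \<beta>: "0 \<le> \<beta>" "\<beta> < 1"
  obtains s where "simple_function M s" "Lp_norm M p s = 1" "\<phi> (Lp_rel M p `` {s}) > \<beta>"
proof -
  let ?E = "Lp M p TYPE('x)"
  let ?cls = "\<lambda>f :: 'w \<Rightarrow> 'x. Lp_rel M p `` {f}"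
  obtain C where C: "C \<ge> 0" "\<And>f. f \<in> Lp_fun M p \<Longrightarrow> \<bar>\<phi> (?cls f)\<bar> \<le> C * Lp_norm M p f"
    using Lp_dual_bound by blast
  have sfLp: "f \<in> Lp_fun M p" if "simple_function M f" for f :: "'w \<Rightarrow> 'x"
    by (rule finite_measure.simple_function_Lp_fun[OF fin that])
  have "?cls (\<lambda>_. 0) \<in> unit_ball ?E"
    by (simp add: Lp_unit_ball_class_iff sfLp) (simp add: Lp_norm_def)
  then have ne: "unit_ball ?E \<noteq> {}" by blast
  have "\<exists>A\<in>unit_ball ?E. \<beta> < \<bar>\<phi> A\<bar>"
  proof (rule ccontr)
    assume "\<not> ?thesis"
    then have "dual_norm ?E \<phi> \<le> \<beta>"
      unfolding dual_norm_def using ne by (intro cSUP_least) auto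
    then show False using norm1 \<beta> by simp
  qed
  then obtain f0 where f0: "f0 \<in> Lp_fun M p" "Lp_norm M p f0 \<le> 1" "\<beta> < \<bar>\<phi> (?cls f0)\<bar>"
    using Lp_unit_ball_class_iff by (fastforce simp: unit_ball_def Lp_vecs_iff)
  \<comment> \<open>The sign removes the absolute value in the dual norm.\<close>
  define f where "f w = sgn (\<phi> (?cls f0)) *\<^sub>R f0 w" for w
  have f: "f \<in> Lp_fun M p" "Lp_norm M p f \<le> 1" "\<beta> < \<phi> (?cls f)"
    using f0 p \<beta> unfolding f_def [abs_def]
    by (auto simp: Lp_fun_scaleR Lp_norm_scaleR Lp_dual_scaleR sgn_if split: if_splits)
  obtain s where s: "\<And>i. simple_function M (s i)"
    and lim0: "(\<lambda>i. Lp_norm M p (\<lambda>w. f w - s i w)) \<longlonglongrightarrow> 0"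
    and lim: "(\<lambda>i. Lp_norm M p (s i)) \<longlonglongrightarrow> Lp_norm M p f"
    using Lp_simple_approx[OF p f(1)] by blast
  have "(\<lambda>i. \<phi> (?cls (s i))) \<longlonglongrightarrow> \<phi> (?cls f)"
  proof (rule LIM_zero_cancel, rule Lim_null_comparison)
    show "(\<lambda>i. C * Lp_norm M p (\<lambda>w. f w - s i w)) \<longlonglongrightarrow> 0"
      using tendsto_mult_left[OF lim0, of C] by simp
    have "norm (\<phi> (?cls (s i)) - \<phi> (?cls f)) \<le> C * Lp_norm M p (\<lambda>w. f w - s i w)" for i
      using C(2)[OF Lp_fun_diff[OF _ f(1) sfLp[OF s]], of i] p Lp_dual_diff[OF f(1) sfLp[OF s], of i]
      by (simp add: abs_minus_commute)
    then show "\<forall>\<^sub>F i in sequentially. norm (\<phi> (?cls (s i)) - \<phi> (?cls f))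
        \<le> C * Lp_norm M p (\<lambda>w. f w - s i w)"
      by simp
  qed
  \<comment> \<open>Positivity of this difference is invariant under scaling by positive reals, so
    once it holds for some \<open>s i\<close> it survives division by the norm.\<close>
  then have "(\<lambda>i. \<phi> (?cls (s i)) - \<beta> * Lp_norm M p (s i)) \<longlonglongrightarrow> \<phi> (?cls f) - \<beta> * Lp_norm M p f"
    by (intro tendsto_intros lim)
  moreover have "0 < \<phi> (?cls f) - \<beta> * Lp_norm M p f"
    using f(3) mult_left_mono[OF f(2) \<beta>(1)] by simp
  ultimately have "\<forall>\<^sub>F i in sequentially. 0 < \<phi> (?cls (s i)) - \<beta> * Lp_norm M p (s i)"
    by (rule order_tendstoD)
  then obtain i where i: "\<beta> * Lp_norm M p (s i) < \<phi> (?cls (s i))"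
    by (auto simp: eventually_sequentially)
  define N where "N = Lp_norm M p (s i)"
  \<comment> \<open>If \<open>N\<close> were 0, boundedness would make \<open>\<phi>\<close> vanish
    at the class of \<open>s i\<close>, against the strict inequality \<open>i\<close>.\<close>
  have "N > 0"
    using C(2)[OF sfLp[OF s, of i]] i Lp_norm_nonneg[of M p "s i"]
    by (cases "N = 0") (auto simp: N_def)
  show ?thesis
  proof (rule that[of "\<lambda>w. (1 / N) *\<^sub>R s i w"])
    show "simple_function M (\<lambda>w. (1 / N) *\<^sub>R s i w)"
      by (rule simple_function_compose1[OF s])
    show "Lp_norm M p (\<lambda>w. (1 / N) *\<^sub>R s i w) = 1"
      using \<open>N > 0\<close> p by (subst Lp_norm_scaleR) (auto simp: N_def)
    show "\<beta> < \<phi> (?cls (\<lambda>w. (1 / N) *\<^sub>R s i w))"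
      using \<open>N > 0\<close> i Lp_dual_scaleR[OF sfLp[OF s], of "1 / N" i]
      by (simp add: N_def pos_less_divide_eq)
  qed
qed

text \<open>The functional \<open>g x\<close> evaluates \<open>\<phi>\<close> on the function equal
  to \<open>norm x *\<^sub>R y\<close> on the level set of \<open>x\<close> and 0 elsewhere. The
  weight \<open>norm x\<close> lets the vectors \<open>y x\<close> range over the unit ball while
  the function stays dominated by \<open>s\<close>.\<close>

lemma Lp_dual_simple_function_decomposition:
  fixes s :: "'w \<Rightarrow> 'x"
  assumes fin: "finite_measure M" and s: "simple_function M s"
  obtains g where "\<And>x. bounded_linear (g x)"
    "\<And>y. \<phi> (Lp_rel M p `` {\<lambda>w. norm (s w) *\<^sub>R y (s w)}) = (\<Sum>x\<in>s ` space M. g x (y x))"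
proof -
  let ?cls = "\<lambda>f :: 'w \<Rightarrow> 'x. Lp_rel M p `` {f}"
  have Lp: "(\<lambda>w. v (s w)) \<in> Lp_fun M p" for v :: "'x \<Rightarrow> 'x"
    by (rule finite_measure.simple_function_Lp_fun[OF fin simple_function_compose1[OF s]])
  obtain C where C: "C \<ge> 0" "\<And>f. f \<in> Lp_fun M p \<Longrightarrow> \<bar>\<phi> (?cls f)\<bar> \<le> C * Lp_norm M p f"
    using Lp_dual_bound by blast
  define h where "h x y w = (if s w = x then norm x *\<^sub>R y else 0)" for x y :: 'x and w
  define g where "g x y = \<phi> (?cls (h x y))" for x y
  have h: "h x y \<in> Lp_fun M p" for x y
    unfolding h_def [abs_def] by (rule Lp)
  show ?thesis
  proof (rule that[of g])
    fix x
    \<comment> \<open>The scalar profile of \<open>h x y\<close>: pointwise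
      \<open>norm (h x y w) = norm y * u w\<close>, so the p-norm of \<open>h x y\<close> is linear
      in \<open>norm y\<close>.\<close>
    define u :: "'w \<Rightarrow> real" where "u w = (if s w = x then norm x else 0)" for w
    show "bounded_linear (g x)"
    proof (rule bounded_linear_intro)
      fix y z
      have "h x (y + z) = (\<lambda>w. h x y w + h x z w)"
        by (auto simp: h_def scaleR_add_right)
      then show "g x (y + z) = g x y + g x z"
        by (simp add: g_def Lp_dual_add h)
    next
      fix c y
      have "h x (c *\<^sub>R y) = (\<lambda>w. c *\<^sub>R h x y w)"
        by (auto simp: h_def)
      then show "g x (c *\<^sub>R y) = c *\<^sub>R g x y"
        by (simp add: g_def Lp_dual_scaleR h)
    next
      fix y
      have "Lp_norm M p (h x y) = Lp_norm M p (\<lambda>w. norm y *\<^sub>R u w)"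
        unfolding Lp_norm_def
        by (intro arg_cong[where f = "\<lambda>t. t powr _"] Bochner_Integration.integral_cong)
          (auto simp: h_def u_def mult.commute)
      also have "\<dots> = norm y * Lp_norm M p u"
        using p by (subst Lp_norm_scaleR) auto
      finally show "norm (g x y) \<le> norm y * (C * Lp_norm M p u)"
        using C(2)[OF h[of x y]] by (simp add: g_def mult_ac)
    qed
  next
    fix y :: "'x \<Rightarrow> 'x"
    let ?R = "s ` space M"
    have R: "finite ?R" using s by (rule simple_functionD)
    have sum: "(\<lambda>w. \<Sum>x\<in>?R. h x (y x) w) \<in> Lp_fun M p"
      using p R h by (intro Lp_fun_sum) auto
    \<comment> \<open>Only the summand with \<open>x = s w\<close> survives. Outside
      \<open>space M\<close> the value \<open>s w\<close> may be missing from the index set, hence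
      the passage to classes.\<close>
    have "norm (s w) *\<^sub>R y (s w) = (\<Sum>x\<in>?R. h x (y x) w)" if "w \<in> space M" for w
      using that R by (simp add: h_def)
    then have "(\<lambda>w. norm (s w) *\<^sub>R y (s w), \<lambda>w. \<Sum>x\<in>?R. h x (y x) w) \<in> Lp_rel M p"
      using sum Lp[of "\<lambda>x. norm x *\<^sub>R y x"] by (auto simp: Lp_rel_def)
    then have "?cls (\<lambda>w. norm (s w) *\<^sub>R y (s w)) = ?cls (\<lambda>w. \<Sum>x\<in>?R. h x (y x) w)"
      by (rule equiv_class_eq[OF equiv_Lp_rel])
    then show "\<phi> (?cls (\<lambda>w. norm (s w) *\<^sub>R y (s w))) = (\<Sum>x\<in>?R. g x (y x))"
      using R h by (simp add: Lp_dual_sum g_def)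
  qed
qed

end

section \<open>Separated points in slices of the ball of X\<close>

text \<open>For nonzero \<open>g\<close> the points come from the slice that
  \<open>g / onorm g\<close> and \<open>\<delta>\<close> determine. The conclusions on
  \<open>g\<close> are non-strict so that they also cover \<open>g = 0\<close>, which determines no
  slice.\<close>

lemma separated_points_in_slice:
  fixes g :: "'x::real_normed_vector \<Rightarrow> real"
  assumes ex: "\<exists>x::'x. x \<noteq> 0" and \<eta>: "0 < \<eta>" "\<eta> \<le> 2" and \<delta>: "0 < \<delta>"
    and diam: "\<And>(\<phi> :: 'x \<Rightarrow>\<^sub>L real) \<alpha>. norm \<phi> = 1 \<Longrightarrow> \<alpha> > 0 \<Longrightarrow>
      \<eta> \<le> diameter {x \<in> cball 0 1. blinfun_apply \<phi> x > 1 - \<alpha>}"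
    and g: "bounded_linear g"
  obtains y z where "norm y \<le> 1" "norm z \<le> 1" "dist y z \<ge> \<eta> / 2"
    "g y \<ge> (1 - \<delta>) * onorm g" "g z \<ge> (1 - \<delta>) * onorm g"
proof (cases "onorm g = 0")
  \<comment> \<open>The conditions on \<open>g\<close> become trivial, and antipodal unit vectors
    have distance 2.\<close>
  case True
  then have "g x = 0" for x using onorm[OF g, of x] by simp
  moreover obtain x :: 'x where "x \<noteq> 0" using ex by blast
  moreover have "dist (sgn x) (- sgn x) = 2"
  proof -
    have "sgn x - - sgn x = 2 *\<^sub>R sgn x" by (simp add: scaleR_2)
    then show ?thesis using \<open>x \<noteq> 0\<close> by (simp add: dist_norm norm_sgn)
  qed
  ultimately show ?thesis
    using that[of "sgn x" "- sgn x"] True \<eta> by (simp add: norm_sgn)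
next
  case False
  then have pos: "onorm g > 0" using onorm_pos_le[OF g] by simp
  define \<phi> where "\<phi> = (1 / onorm g) *\<^sub>R Blinfun g"
  have app: "blinfun_apply \<phi> x = g x / onorm g" for x
    by (simp add: \<phi>_def blinfun.scaleR_left bounded_linear_Blinfun_apply g)
  have "norm \<phi> = 1"
    using pos by (simp add: \<phi>_def) (simp add: norm_blinfun.rep_eq bounded_linear_Blinfun_apply g)
  \<comment> \<open>The supremum defining the diameter need not be attained; halving
    \<open>\<eta>\<close> gives the strict inequality that yields actual points.\<close>
  from diam[OF this \<delta>] \<eta> have "\<eta> / 2 < diameter {x \<in> cball 0 1. blinfun_apply \<phi> x > 1 - \<delta>}"
    by simp
  moreover have "bounded {x \<in> cball 0 1. blinfun_apply \<phi> x > 1 - \<delta>}"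
    by (rule bounded_subset[OF bounded_cball[of 0 1]]) auto
  ultimately obtain y z where "y \<in> {x \<in> cball 0 1. blinfun_apply \<phi> x > 1 - \<delta>}"
    "z \<in> {x \<in> cball 0 1. blinfun_apply \<phi> x > 1 - \<delta>}" "\<eta> / 2 < dist y z"
    using diameter_lower_bounded[of _ "\<eta> / 2"] \<eta> by force
  then show ?thesis
    using that[of y z] pos by (simp add: app less_divide_eq)
qed

section \<open>Two distant elements in a small slice of the ball of L^p\<close>

theorem proposition3p2:
  fixes M :: "'w measure" and p :: real
  assumes "finite_measure M" and "measure M (space M) > 0"
    and "\<exists>x::'x::banach. x \<noteq> 0"
    and "1 \<le> p"
    and "BDP (Lp M p TYPE('x))"
  shows "BDP (type_space TYPE('x))"
proof (rule ccontr)
  let ?E = "Lp M p TYPE('x)"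
  let ?cls = "\<lambda>f :: 'w \<Rightarrow> 'x. Lp_rel M p `` {f}"
  assume "\<not> BDP (type_space TYPE('x))"
  then obtain \<eta>0 where \<eta>0: "\<eta>0 > 0" "\<And>(\<phi> :: 'x \<Rightarrow>\<^sub>L real) \<alpha>. norm \<phi> = 1 \<Longrightarrow> \<alpha> > 0 \<Longrightarrow>
      \<eta>0 \<le> diameter {x \<in> cball 0 1. blinfun_apply \<phi> x > 1 - \<alpha>}"
    unfolding BDP_type_space_iff by (meson not_less)
  \<comment> \<open>The cap at 2 keeps the required separation available for the zero functional as
    well.\<close>
  define \<eta> where "\<eta> = min \<eta>0 2"
  have \<eta>: "0 < \<eta>" "\<eta> \<le> 2" "\<And>(\<phi> :: 'x \<Rightarrow>\<^sub>L real) \<alpha>. norm \<phi> = 1 \<Longrightarrow> \<alpha> > 0 \<Longrightarrow>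
      \<eta> \<le> diameter {x \<in> cball 0 1. blinfun_apply \<phi> x > 1 - \<alpha>}"
    using \<eta>0 by (auto simp: \<eta>_def min.coboundedI1)
  obtain \<phi> \<alpha> where \<phi>: "\<phi> \<in> dual_space ?E" "dual_norm ?E \<phi> = 1" and \<alpha>: "\<alpha> > 0"
    and small: "vdiameter ?E (slice ?E \<phi> \<alpha>) < \<eta> / 2"
    using assms(5) \<eta>(1) unfolding BDP_def dual_sphere_def by (fastforce dest: spec[of _ "\<eta> / 2"])
  \<comment> \<open>If \<open>\<alpha>\<close> exceeds 1, the threshold \<open>1 - \<alpha>\<close>
    is negative; cutting it off at 0 gives the nonnegative \<open>\<beta>\<close> that the norming
    lemma asks for.\<close>
  define \<beta> where "\<beta> = max 0 (1 - \<alpha>)"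
  have \<beta>: "0 \<le> \<beta>" "\<beta> < 1" "1 - \<alpha> \<le> \<beta>" using \<alpha> by (auto simp: \<beta>_def)
  obtain s where s: "simple_function M s" "Lp_norm M p s = 1" "\<phi> (?cls s) > \<beta>"
    using Lp_dual_norming_simple_function[OF assms(4) \<phi>(1) assms(1) \<phi>(2) \<beta>(1,2)] by blast
  obtain g where g: "\<And>x. bounded_linear (g x)"
    "\<And>y. \<phi> (?cls (\<lambda>w. norm (s w) *\<^sub>R y (s w))) = (\<Sum>x\<in>s ` space M. g x (y x))"
    using Lp_dual_simple_function_decomposition[OF assms(4) \<phi>(1) assms(1) s(1)] by blast
  have Lp: "(\<lambda>w. v (s w)) \<in> Lp_fun M p" for v :: "'x \<Rightarrow> 'x"
    by (rule finite_measure.simple_function_Lp_fun[OF assms(1) simple_function_compose1[OF s(1)]])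
  define T where "T = (\<Sum>x\<in>s ` space M. onorm (g x))"
  \<comment> \<open>The choice \<open>sgn\<close> of ball vectors reproduces \<open>s\<close>
    itself, so \<open>\<phi>\<close> at \<open>s\<close> is at most the sum \<open>T\<close> of the
    norms of the \<open>g x\<close>.\<close>
  have "norm (s w) *\<^sub>R sgn (s w) = s w" for w
    by (cases "s w = 0") (simp_all add: sgn_div_norm)
  then have "\<phi> (?cls s) = (\<Sum>x\<in>s ` space M. g x (sgn x))"
    using g(2)[of sgn] by simp
  also have "\<dots> \<le> T"
    unfolding T_def
  proof (rule sum_mono)
    fix x
    have "g x (sgn x) \<le> onorm (g x) * norm (sgn x)"
      using onorm[OF g(1), of x "sgn x"] by simp
    also have "\<dots> \<le> onorm (g x)"
      using onorm_pos_le[OF g(1)] by (simp add: norm_sgn)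
    finally show "g x (sgn x) \<le> onorm (g x)" .
  qed
  finally have T: "\<beta> < T" using s(3) by simp
  \<comment> \<open>Chosen so that \<open>(1 - \<delta>) * T\<close> is the midpoint of
    \<open>\<beta>\<close> and \<open>T\<close>; the division is safe because
    \<open>T > \<beta> \<ge> 0\<close>.\<close>
  define \<delta> where "\<delta> = (T - \<beta>) / (2 * T)"
  have \<delta>: "\<delta> > 0" "\<beta> < (1 - \<delta>) * T"
    using T \<beta> by (auto simp: \<delta>_def field_simps)
  have "\<exists>y z. norm y \<le> 1 \<and> norm z \<le> 1 \<and> dist y z \<ge> \<eta> / 2 \<and>
      g x y \<ge> (1 - \<delta>) * onorm (g x) \<and> g x z \<ge> (1 - \<delta>) * onorm (g x)" for x
    using separated_points_in_slice[OF assms(3) \<eta>(1,2) \<delta>(1) \<eta>(3) g(1)] by metis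
  then obtain y z where yz: "\<And>x. norm (y x) \<le> 1" "\<And>x. norm (z x) \<le> 1"
    "\<And>x. dist (y x) (z x) \<ge> \<eta> / 2"
    "\<And>x. g x (y x) \<ge> (1 - \<delta>) * onorm (g x)" "\<And>x. g x (z x) \<ge> (1 - \<delta>) * onorm (g x)"
    by metis
  define F where "F v w = norm (s w) *\<^sub>R v (s w)" for v :: "'x \<Rightarrow> 'x" and w
  have F: "F v \<in> Lp_fun M p" for v
    unfolding F_def [abs_def] by (rule Lp)
  have slice: "?cls (F v) \<in> slice ?E \<phi> \<alpha>"
    if v: "\<And>x. norm (v x) \<le> 1" "\<And>x. g x (v x) \<ge> (1 - \<delta>) * onorm (g x)" for v
  proof -
    have "Lp_norm M p (F v) \<le> Lp_norm M p s"
      using assms(4) F Lp[of "\<lambda>x. x"] v(1)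
      by (intro Lp_norm_mono) (auto simp: F_def mult_left_le)
    then have "?cls (F v) \<in> unit_ball ?E"
      using F s(2) by (simp add: Lp_unit_ball_class_iff)
    moreover have "(1 - \<delta>) * T \<le> (\<Sum>x\<in>s ` space M. g x (v x))"
      unfolding T_def sum_distrib_left by (intro sum_mono v)
    then have "\<phi> (?cls (F v)) > 1 - \<alpha>"
      using \<delta>(2) \<beta>(3) g(2)[of v] by (simp add: F_def [abs_def])
    ultimately show ?thesis by (simp add: slice_def)
  qed
  \<comment> \<open>Since \<open>s\<close> has norm 1, \<open>\<eta> / 2\<close> is itself a p-norm,
    and the separation of \<open>y x\<close> from \<open>z x\<close> for each value \<open>x\<close>
    of \<open>s\<close> allows a pointwise comparison.\<close>
  have "\<eta> / 2 = Lp_norm M p (\<lambda>w. (\<eta> / 2) *\<^sub>R s w)"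
    using assms(4) \<eta>(1) s(2) by (subst Lp_norm_scaleR) auto
  also have "\<dots> \<le> Lp_norm M p (\<lambda>w. F y w - F z w)"
  proof (rule Lp_norm_mono)
    show "norm ((\<eta> / 2) *\<^sub>R s w) \<le> norm (F y w - F z w)" for w
    proof -
      have "norm (F y w - F z w) = norm (s w) * dist (y (s w)) (z (s w))"
        by (simp add: F_def dist_norm flip: scaleR_diff_right)
      then show ?thesis
        using mult_left_mono[OF yz(3), of "norm (s w)" "s w"] \<eta>(1) by (simp add: mult.commute)
    qed
  qed (use assms(4) F Lp[of "\<lambda>x. (\<eta> / 2) *\<^sub>R x"] in \<open>auto intro: Lp_fun_diff\<close>)
  also have "\<dots> = vdist ?E (?cls (F y)) (?cls (F z))"
    using assms(4) F by (simp add: Lp_vdist_class)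
  also have "\<dots> \<le> vdiameter ?E (slice ?E \<phi> \<alpha>)"
    using yz by (intro Lp_vdist_le_vdiameter slice assms(4)) (auto simp: slice_def)
  finally show False using small by simp
qed

end
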